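(* For every $\epsilon > 0$ there exists a Radon probability measure $\mu$ on $\mathbb{R}^2$ supported on $[0,1]^2$ with the following properties: (i) for all $x \in \operatorname{spt}\mu$, $$\int_0^\infty \beta_{2,\mu}(B(x,r))^2\, \frac{dr}{\mu(B(x,r))} \leq \epsilon;$$ (ii) if $\Gamma \subset \mathbb{R}^2$ is any $\mathcal{H}^1$-measurable set with $\mathcal{H}^1(\Gamma) \leq 1$, then $\mu(\Gamma) \leq \epsilon$.
   Context: $B(x,r)$ is the open ball of radius $r>0$ centred at $x \in \mathbb{R}^2$, $\operatorname{spt}\mu$ is the (closed) support of $\mu$, and $\mathcal{H}^1$ is $1$-dimensional Hausdorff measure. For a Radon measure $\mu$ on $\mathbb{R}^2$ and a ball $B = B(x,r)$ with $\mu(B) > 0$, $$\beta_{2,\mu}(B) = \inf_L \left[ \frac{1}{\mu(B)} \int_B \left( \frac{d(y,L)}{\operatorname{diam}(B)} \right)^2 d\mu(y) \right]^{1/2},$$ where the infimum is over all affine lines $L \subset \mathbb{R}^2$ and $d(y,L)$ is the Euclidean distance from $y$ to $L$. *)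

theory Defs
  imports "HOL-Probability.Probability"
begin

definition radon_measure :: "'a::topological_space measure \<Rightarrow> bool" where
  "radon_measure \<mu> \<longleftrightarrow>
     sets \<mu> = sets borel \<and>
     (\<forall>K. compact K \<longrightarrow> emeasure \<mu> K < \<infinity>) \<and>
     (\<forall>A\<in>sets borel. emeasure \<mu> A = (INF U\<in>{U. open U \<and> A \<subseteq> U}. emeasure \<mu> U)) \<and>
     (\<forall>U. open U \<longrightarrow> emeasure \<mu> U = (SUP K\<in>{K. compact K \<and> K \<subseteq> U}. emeasure \<mu> K))"

definition spt :: "'a::topological_space measure \<Rightarrow> 'a set" where
  "spt \<mu> = {x. \<forall>U. open U \<and> x \<in> U \<longrightarrow> emeasure \<mu> U > 0}"

definition affine_lines :: "(real^2) set set" where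
  "affine_lines = {L. affine L \<and> aff_dim L = 1}"

text \<open>Real-valued, for balls \<open>B\<close> with \<open>0 < \<mu>(B) < \<infinity>\<close>: the integrand is continuous and bounded on
  \<open>B\<close>, and the infimum is over a nonempty set of nonnegative reals.\<close>

definition beta2 :: "(real^2) measure \<Rightarrow> (real^2) set \<Rightarrow> real" where
  "beta2 \<mu> B =
     (INF L\<in>affine_lines.
        sqrt (1 / measure \<mu> B * (LINT y:B|\<mu>. (infdist y L / diameter B)\<^sup>2)))"

text \<open>One-dimensional Hausdorff measure as an outer measure on all subsets, normalised as the
  infimum of sums of diameters. Covering sets are required to be bounded because
  \<^const>\<open>diameter\<close> has no meaningful value on unbounded sets.\<close>

definition hausdorff1_pre :: "real \<Rightarrow> 'a::metric_space set \<Rightarrow> ennreal" where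
  "hausdorff1_pre \<delta> A =
     (INF E\<in>{E :: nat \<Rightarrow> 'a set. A \<subseteq> (\<Union>i. E i) \<and> (\<forall>i. bounded (E i) \<and> diameter (E i) \<le> \<delta>)}.
        (\<Sum>i. ennreal (diameter (E i))))"

definition hausdorff1 :: "'a::metric_space set \<Rightarrow> ennreal" where
  "hausdorff1 A = (SUP \<delta>\<in>{0<..}. hausdorff1_pre \<delta> A)"

text \<open>Measurability in the sense of Caratheodory.\<close>

definition hausdorff1_measurable :: "'a::metric_space set \<Rightarrow> bool" where
  "hausdorff1_measurable A \<longleftrightarrow> A \<in> lambda_system UNIV (Pow UNIV) hausdorff1"

end

theory Submission
  imports Defs "HOL-Real_Asymp.Real_Asymp"
begin

text \<open>
  The measure lives on finitely many parallel horizontal segments of a small length \<open>l\<close>: a heavy one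
  of mass \<open>\<eta>\<close> at height 0, and many light ones of mass \<open>1 / n\<close> at rapidly decreasing heights \<open>h\<^sub>j\<close>.

  A set of length 1 covers little mass: the heavy segment has mass \<open>\<eta>\<close>, and the light ones have
  linear density \<open>1 / (n l)\<close>, which is small once \<open>n\<close> is large.

  For the Jones integral at a point of height \<open>h\<close>, balls of radius \<open>r \<le> (1 - 1/n) h\<close> see a single
  segment, so that \<open>\<beta> = 0\<close>; the radii between \<open>(1 - 1/n) h\<close> and \<open>h\<close> contribute the order of \<open>l\<close>. For \<open>h < r < 2 h\<close> the ball contains a chord of length at least
  \<open>\<surd>(h (r - h))\<close> of the heavy segment, and \<open>\<beta> \<le> 1\<close> gives a contribution of order \<open>l / \<eta>\<close>. For
  \<open>r \<ge> 2 h\<close> the mass of the ball is at least of order \<open>\<eta> r / l\<close>, and approximation by the heavy line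
  costs \<open>h\<^sub>j\<^sup>2 / r\<^sup>2\<close> on the light segment \<open>j\<close>, which enters only for \<open>r > h\<^sub>j / 2\<close>: each of the \<open>n\<close>
  segments contributes at most the order of \<open>l / (n \<eta>\<^sup>2)\<close>. The total, of order \<open>l / \<eta>\<^sup>2\<close>, does not
  depend on \<open>n\<close>, hence is small if \<open>l\<close> is chosen after \<open>\<eta>\<close> and before \<open>n\<close>.
\<close>

section \<open>Horizontal segments and the mass of balls on them\<close>

definition pt :: "real \<Rightarrow> real \<Rightarrow> real^2" where
  "pt t s = (\<chi> i. if i = 1 then t else s)"

definition seg :: "real \<Rightarrow> real \<Rightarrow> (real^2) measure" where
  "seg l s = distr (uniform_measure lborel {0..l}) borel (\<lambda>t. pt t s)"

text \<open>An index is drawn uniformly, then a point of its segment. Heights may repeat, so a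
  segment of mass \<open>k / n\<close> is one whose height is taken by \<open>k\<close>
  indices.\<close>

definition stack :: "real \<Rightarrow> nat \<Rightarrow> (nat \<Rightarrow> real) \<Rightarrow> (real^2) measure" where
  "stack l n h = measure_pmf (pmf_of_set {..<n}) \<bind> (\<lambda>j. seg l (h j))"

lemma pt_nth [simp]: "pt t s $ 1 = t" "pt t s $ 2 = s"
  by (simp_all add: pt_def)

lemma pt_eta: "pt (y $ 1) (y $ 2) = y"
  by (simp add: vec_eq_iff forall_2)

lemma dist_pt: "dist (pt a b) (pt c d) = sqrt ((a - c)\<^sup>2 + (b - d)\<^sup>2)"
  by (simp add: dist_vec_def L2_set_def UNIV_2 dist_real_def)

lemma dist_pt_less_iff:
  assumes "r > 0"
  shows "dist (pt a b) (pt c d) < r \<longleftrightarrow> (a - c)\<^sup>2 + (b - d)\<^sup>2 < r\<^sup>2"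
  using assms real_less_rsqrt real_sqrt_less_iff[of _ "r\<^sup>2"] by (simp add: dist_pt)

lemma continuous_on_pt: "continuous_on A (\<lambda>t. pt t s)"
proof -
  have "continuous_on A (\<lambda>t. if i = 1 then t else s)" for i :: 2
    by (cases "i = 1") (auto intro: continuous_intros)
  then show ?thesis
    unfolding pt_def by (rule continuous_on_vec_lambda)
qed

lemma borel_measurable_pt [measurable]: "(\<lambda>t. pt t s) \<in> borel_measurable borel"
  by (intro borel_measurable_continuous_onI continuous_on_pt)

lemma sets_seg [simp, measurable_cong]: "sets (seg l s) = sets borel"
  by (simp add: seg_def)

lemma space_seg [simp]: "space (seg l s) = UNIV"
  by (simp add: seg_def)

lemma prob_space_seg:
  assumes "l > 0"
  shows "prob_space (seg l s)"
  unfolding seg_def using assms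
  by (intro prob_space.prob_space_distr prob_space_uniform_measure) auto

lemma measure_seg:
  assumes "l > 0" "A \<in> sets borel"
  shows "measure (seg l s) A = measure lborel {t\<in>{0..l}. pt t s \<in> A} / l"
proof -
  have meas: "(\<lambda>t. pt t s) -` A \<in> sets borel"
    using measurable_sets[OF borel_measurable_pt assms(2)] by simp
  have "measure (seg l s) A = measure (uniform_measure lborel {0..l}) ((\<lambda>t. pt t s) -` A)"
    unfolding seg_def using assms by (subst measure_distr) auto
  also have "\<dots> = measure lborel ({0..l} \<inter> (\<lambda>t. pt t s) -` A) / measure lborel {0..l}"
    using assms meas by (subst measure_uniform_measure) auto
  also have "{0..l} \<inter> (\<lambda>t. pt t s) -` A = {t\<in>{0..l}. pt t s \<in> A}"
    by auto
  finally show ?thesis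
    using assms by simp
qed

lemma measure_seg_le_1:
  assumes "l > 0"
  shows "measure (seg l s) A \<le> 1"
  using prob_space.prob_le_1[OF prob_space_seg[OF assms]] .

lemma measure_seg_le:
  assumes "l > 0" "A \<in> sets borel" "d \<ge> 0" "\<And>t. 0 \<le> t \<Longrightarrow> t \<le> l \<Longrightarrow> pt t s \<in> A \<Longrightarrow> t \<in> {c..c + d}"
  shows "measure (seg l s) A \<le> d / l"
proof -
  have "measure lborel {t\<in>{0..l}. pt t s \<in> A} \<le> measure lborel {c..c + d}"
    by (rule measure_mono_fmeasurable)
       (use assms measurable_sets[OF borel_measurable_pt assms(2), of s] in
         \<open>auto simp: fmeasurable_def Collect_conj_eq vimage_def\<close>)
  then show ?thesis
    using assms by (simp add: measure_seg divide_right_mono)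
qed

lemma measure_seg_eq_0:
  assumes "l > 0" "A \<in> sets borel" "\<And>t. 0 \<le> t \<Longrightarrow> t \<le> l \<Longrightarrow> pt t s \<notin> A"
  shows "measure (seg l s) A = 0"
proof -
  have "{t\<in>{0..l}. pt t s \<in> A} = {}" using assms(3) by auto
  then show ?thesis
    using assms(1,2) by (simp only: measure_seg) simp
qed

lemma measure_seg_ball_eq_0:
  assumes "l > 0" "r \<le> \<bar>s - h\<bar>"
  shows "measure (seg l s) (ball (pt a h) r) = 0"
proof -
  have "\<bar>s - h\<bar> \<le> dist (pt a h) (pt t s)" for t
    unfolding dist_pt by (rule real_le_rsqrt) (simp add: power2_commute)
  then have "pt t s \<notin> ball (pt a h) r" for t
    using assms(2) by (auto simp: not_less intro: order.trans)
  then show ?thesis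
    using assms(1) by (intro measure_seg_eq_0) auto
qed

lemma measure_seg_ball_le:
  assumes "l > 0" "r > 0"
  shows "measure (seg l s) (ball (pt a h) r) \<le> min 1 (2 * r / l)"
proof -
  have "\<bar>t - a\<bar> \<le> r" if "pt t s \<in> ball (pt a h) r" for t
  proof -
    have "\<bar>t - a\<bar> \<le> dist (pt a h) (pt t s)"
      unfolding dist_pt by (rule real_le_rsqrt) (simp add: power2_commute)
    with that show ?thesis by simp
  qed
  then have "measure (seg l s) (ball (pt a h) r) \<le> 2 * r / l"
    using assms by (intro measure_seg_le[where c = "a - r"]) (auto simp: abs_le_iff, fastforce+)
  then show ?thesis
    using measure_seg_le_1[OF assms(1)] by simp
qed

text \<open>The chord at height \<open>s\<close> is centred at \<open>a\<close> and has half-length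
  at least \<sigma>. Since \<open>a\<close> lies in \<open>[0, l]\<close>, its part on the segment
  has length at least \<open>min l \<sigma>\<close>, whichever ends are cut off.\<close>

lemma measure_seg_ball_ge:
  assumes "l > 0" "r > 0" "0 \<le> a" "a \<le> l" "0 \<le> \<sigma>" "\<sigma>\<^sup>2 \<le> r\<^sup>2 - (s - h)\<^sup>2"
  shows "min 1 (\<sigma> / l) \<le> measure (seg l s) (ball (pt a h) r)"
proof -
  have "min l \<sigma> \<le> measure lborel {max 0 (a - \<sigma>)<..<min l (a + \<sigma>)}"
    using assms by auto
  also have "\<dots> \<le> measure lborel {t\<in>{0..l}. pt t s \<in> ball (pt a h) r}"
  proof (rule measure_mono_fmeasurable)
    show "{max 0 (a - \<sigma>)<..<min l (a + \<sigma>)} \<subseteq> {t \<in> {0..l}. pt t s \<in> ball (pt a h) r}"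
    proof
      fix t assume t: "t \<in> {max 0 (a - \<sigma>)<..<min l (a + \<sigma>)}"
      then have "\<bar>a - t\<bar> < \<sigma>" by auto
      then have "(a - t)\<^sup>2 < \<sigma>\<^sup>2" using assms(5) by (simp add: abs_square_less_1 power2_strict_mono)
      with t show "t \<in> {t \<in> {0..l}. pt t s \<in> ball (pt a h) r}"
        using assms by (auto simp: dist_pt_less_iff power2_commute[of h s])
    qed
    have "(\<lambda>t. pt t s) -` ball (pt a h) r \<in> sets borel"
      using measurable_sets[OF borel_measurable_pt, of "ball (pt a h) r" s] by simp
    moreover have "{t \<in> {0..l}. pt t s \<in> ball (pt a h) r} = {0..l} \<inter> (\<lambda>t. pt t s) -` ball (pt a h) r"
      by auto
    moreover have "emeasure lborel ({0..l} \<inter> X) < \<infinity>" for X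
      using emeasure_mono[of "{0..l} \<inter> X" "{0..l}" lborel] assms(1)
      by (simp add: order.strict_trans1)
    ultimately show "{t \<in> {0..l}. pt t s \<in> ball (pt a h) r} \<in> fmeasurable lborel"
      by (auto simp: fmeasurable_def)
  qed auto
  finally have "min l \<sigma> / l \<le> measure (seg l s) (ball (pt a h) r)"
    using assms by (simp add: measure_seg divide_right_mono)
  moreover have "min l \<sigma> / l = min 1 (\<sigma> / l)"
    using assms by (simp add: min_def field_simps)
  ultimately show ?thesis by simp
qed

section \<open>Mixtures of segments: masses, regularity, support\<close>

lemma seg_measurable:
  assumes "l > 0"
  shows "(\<lambda>j. seg l (h j)) \<in> measurable (measure_pmf p) (subprob_algebra borel)"
  using assms by (auto simp: space_subprob_algebra prob_space_seg prob_space_imp_subprob_space)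

lemma sets_stack [simp, measurable_cong]: "sets (stack l n h) = sets borel"
  by (simp add: stack_def)

lemma space_stack [simp]: "space (stack l n h) = UNIV"
  using sets_eq_imp_space_eq[OF sets_stack] by simp

lemma nn_integral_stack:
  assumes "l > 0" "n > 0" and [measurable]: "f \<in> borel_measurable borel"
  shows "(\<integral>\<^sup>+y. f y \<partial>stack l n h) = (\<Sum>j<n. \<integral>\<^sup>+y. f y \<partial>seg l (h j)) / n"
  unfolding stack_def using assms
  by (subst nn_integral_bind[OF _ seg_measurable])
     (auto simp: nn_integral_pmf_of_set lessThan_empty_iff)

lemma emeasure_stack:
  assumes "l > 0" "n > 0" "A \<in> sets borel"
  shows "emeasure (stack l n h) A = ennreal ((\<Sum>j<n. measure (seg l (h j)) A) / n)"
proof -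
  have "emeasure (seg l s) A = ennreal (measure (seg l s) A)" for s
    using prob_space_seg[OF assms(1)] finite_measure.emeasure_eq_measure prob_space_def by blast
  moreover have "emeasure (stack l n h) A = (\<Sum>j<n. emeasure (seg l (h j)) A) / n"
    using nn_integral_stack[OF assms(1,2), of "indicator A" h] assms(3) by simp
  ultimately show ?thesis
    using assms by (simp add: sum_nonneg divide_ennreal ennreal_of_nat_eq_real_of_nat)
qed

lemma measure_stack:
  assumes "l > 0" "n > 0" "A \<in> sets borel"
  shows "measure (stack l n h) A = (\<Sum>j<n. measure (seg l (h j)) A) / n"
  using emeasure_stack[OF assms] by (simp add: measure_def sum_nonneg)

lemma prob_space_stack:
  assumes "l > 0" "n > 0"
  shows "prob_space (stack l n h)"
proof
  have "measure (seg l (h j)) UNIV = 1" for j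
    using prob_space.prob_space[OF prob_space_seg[OF assms(1)]] by simp
  then show "emeasure (stack l n h) (space (stack l n h)) = 1"
    using assms by (simp add: emeasure_stack)
qed

lemma radon_measure_finite_borel:
  fixes M :: "'a::{second_countable_topology, complete_space} measure"
  assumes "finite_measure M" "sets M = sets borel"
  shows "radon_measure M"
proof -
  have fin: "emeasure M A \<noteq> \<infinity>" for A
    using finite_measure.emeasure_finite[OF assms(1)] by simp
  show ?thesis
    unfolding radon_measure_def
    using inner_regular[OF assms(2) fin] outer_regular[OF assms(2) fin] assms(2) fin
    by (auto simp: conj_commute less_top)
qed

lemma spt_stack_subset:
  assumes "l > 0" "n > 0"
  shows "spt (stack l n h) \<subseteq> {pt a (h j) |a j. 0 \<le> a \<and> a \<le> l \<and> j < n}"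
proof
  let ?K = "\<Union>j<n. (\<lambda>t. pt t (h j)) ` {0..l}"
  have "compact ((\<lambda>t. pt t s) ` {0..l})" for s
    by (intro compact_continuous_image continuous_on_pt) simp
  then have cl: "closed ?K"
    by (auto intro: compact_imp_closed)
  have "measure (seg l (h j)) (- ?K) = 0" if "j < n" for j
    using assms(1) that cl by (intro measure_seg_eq_0 borel_open open_Compl) fastforce+
  then have "emeasure (stack l n h) (- ?K) = 0"
    using assms borel_open[OF open_Compl[OF cl]] by (simp only: emeasure_stack) simp
  fix x assume "x \<in> spt (stack l n h)"
  then have "x \<notin> - ?K"
    using open_Compl[OF cl] \<open>emeasure (stack l n h) (- ?K) = 0\<close>
    unfolding spt_def mem_Collect_eq by (metis less_irrefl)
  then show "x \<in> {pt a (h j) |a j. 0 \<le> a \<and> a \<le> l \<and> j < n}" by fastforce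
qed

section \<open>Beta numbers of a stack, tested on horizontal lines\<close>

lemma horizontal_line: "{y. y $ 2 = c} \<in> affine_lines"
proof -
  have "{y :: real^2. y $ 2 = c} = {y. axis 2 1 \<bullet> y = c}"
    by (simp add: inner_axis')
  then show ?thesis
    by (simp add: affine_lines_def affine_hyperplane aff_dim_hyperplane axis_eq_0_iff)
qed

lemma infdist_horizontal_line: "infdist y {y :: real^2. y $ 2 = c} \<le> \<bar>y $ 2 - c\<bar>"
proof -
  have "infdist y {y :: real^2. y $ 2 = c} \<le> dist (pt (y $ 1) (y $ 2)) (pt (y $ 1) c)"
    unfolding pt_eta by (intro infdist_le) simp
  then show ?thesis by (simp add: dist_pt)
qed

lemma beta2_nonneg: "0 \<le> beta2 \<mu> B"
  unfolding beta2_def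
  using horizontal_line by (intro cINF_greatest) (auto simp: set_lebesgue_integral_def)

text \<open>The line at height \<open>c\<close> has constant distance
  \<open>\<bar>h j - c\<bar>\<close> to segment \<open>j\<close>. The weight \<open>1 / n\<close>
  cancels, and \<open>4 * r\<^sup>2\<close> is the squared diameter. For a null ball division by
  zero makes both sides 0.\<close>

lemma beta2_stack_le:
  assumes "l > 0" "n > 0" "r > 0"
  shows "(beta2 (stack l n h) (ball x r))\<^sup>2 \<le>
    (\<Sum>j<n. measure (seg l (h j)) (ball x r) * (h j - c)\<^sup>2) /
      (\<Sum>j<n. measure (seg l (h j)) (ball x r)) / (4 * r\<^sup>2)"
proof -
  let ?\<mu> = "stack l n h" and ?B = "ball x r" and ?L = "{y :: real^2. y $ 2 = c}"
  let ?m = "\<lambda>j. measure (seg l (h j)) (ball x r)"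
  define S where "S = (\<Sum>j<n. ?m j * (h j - c)\<^sup>2)"
  define I where "I = (LINT y:?B|?\<mu>. (infdist y ?L / diameter ?B)\<^sup>2)"
  have y2: "(\<lambda>y :: real^2. y $ 2) \<in> borel_measurable borel"
    by (intro borel_measurable_continuous_onI continuous_intros)
  have S: "0 \<le> S" unfolding S_def by (intro sum_nonneg) simp
  have seg_int: "(\<integral>\<^sup>+y. indicator ?B y * ennreal (((y $ 2 - c) / (2 * r))\<^sup>2) \<partial>seg l s) =
      ennreal (measure (seg l s) ?B * (s - c)\<^sup>2 / (4 * r\<^sup>2))" for s
  proof -
    interpret prob_space "seg l s" by (rule prob_space_seg) fact
    have "AE y in seg l s. y $ 2 = s"
      unfolding seg_def by (subst AE_distr_iff) auto
    then have "(\<integral>\<^sup>+y. indicator ?B y * ennreal (((y $ 2 - c) / (2 * r))\<^sup>2) \<partial>seg l s) =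
       (\<integral>\<^sup>+y. ennreal (((s - c) / (2 * r))\<^sup>2) * indicator ?B y \<partial>seg l s)"
      by (intro nn_integral_cong_AE) (auto simp: mult.commute)
    also have "\<dots> = ennreal (((s - c) / (2 * r))\<^sup>2) * ennreal (measure (seg l s) ?B)"
      by (subst nn_integral_cmult_indicator) (auto simp: emeasure_eq_measure)
    also have "\<dots> = ennreal (((s - c) / (2 * r))\<^sup>2 * measure (seg l s) ?B)"
      by (simp add: ennreal_mult')
    finally show ?thesis by (simp add: power_divide power_mult_distrib mult.commute)
  qed
  have "(\<integral>\<^sup>+y. ennreal (indicator ?B y *\<^sub>R (infdist y ?L / diameter ?B)\<^sup>2) \<partial>?\<mu>) \<le>
    (\<integral>\<^sup>+y. indicator ?B y * ennreal (((y $ 2 - c) / (2 * r))\<^sup>2) \<partial>?\<mu>)"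
  proof (intro nn_integral_mono)
    fix y :: "real^2"
    have "(infdist y ?L / diameter ?B)\<^sup>2 \<le> (\<bar>y $ 2 - c\<bar> / (2 * r))\<^sup>2"
      using assms infdist_horizontal_line[of y c]
      by (intro power_mono) (auto simp: infdist_nonneg divide_right_mono)
    then show "ennreal (indicator ?B y *\<^sub>R (infdist y ?L / diameter ?B)\<^sup>2) \<le>
        indicator ?B y * ennreal (((y $ 2 - c) / (2 * r))\<^sup>2)"
      by (auto simp: indicator_def power_divide intro!: ennreal_leI)
  qed
  also have "\<dots> = ennreal ((\<Sum>j<n. ?m j * (h j - c)\<^sup>2 / (4 * r\<^sup>2)) / n)"
  proof -
    have "(\<lambda>y. indicator ?B y * ennreal (((y $ 2 - c) / (2 * r))\<^sup>2)) \<in> borel_measurable borel"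
      by (intro borel_measurable_times_ennreal borel_measurable_indicator y2
          measurable_compose[OF _ measurable_ennreal] borel_measurable_power
          borel_measurable_divide borel_measurable_diff) auto
    from nn_integral_stack[OF assms(1,2) this] show ?thesis
      using assms by (simp add: seg_int sum_nonneg divide_ennreal ennreal_of_nat_eq_real_of_nat)
  qed
  also have "(\<Sum>j<n. ?m j * (h j - c)\<^sup>2 / (4 * r\<^sup>2)) / n = S / (4 * r\<^sup>2) / n"
    by (simp add: S_def sum_divide_distrib)
  finally have I: "I \<le> S / (4 * r\<^sup>2) / n"
    unfolding I_def set_lebesgue_integral_def using S by (intro integral_real_bounded) auto
  have "I \<ge> 0" unfolding I_def by (simp add: set_lebesgue_integral_def)
  have "beta2 ?\<mu> ?B \<le> sqrt (1 / measure ?\<mu> ?B * I)"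
    unfolding beta2_def I_def
    by (intro cINF_lower bdd_belowI2[of _ 0] horizontal_line) (auto simp: set_lebesgue_integral_def)
  then have "(beta2 ?\<mu> ?B)\<^sup>2 \<le> (sqrt (1 / measure ?\<mu> ?B * I))\<^sup>2"
    using beta2_nonneg by (intro power_mono)
  also have "\<dots> = 1 / measure ?\<mu> ?B * I"
    using \<open>I \<ge> 0\<close> by simp
  also have "\<dots> \<le> 1 / measure ?\<mu> ?B * (S / (4 * r\<^sup>2) / n)"
    using I by (intro mult_left_mono) auto
  also have "\<dots> = S / (\<Sum>j<n. ?m j) / (4 * r\<^sup>2)"
    using assms by (simp add: measure_stack)
  finally show ?thesis unfolding S_def .
qed

section \<open>Two integrals over radii\<close>

text \<open>Cost of one light segment at large radii: \<open>h\<^sup>2 / r\<^sup>2\<close> comes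
  from approximation by the heavy line, and \<open>1 + 2 * l / r\<close> dominates the reciprocal of
  \<open>min 1 (r / 2 / l)\<close>, the relative heavy mass of a ball. Since the integral starts at
  the scale of \<open>h\<close>, the bound does not blow up as \<open>h\<close> tends to 0.\<close>

lemma nn_integral_inverse_power_tail:
  fixes h l :: real
  assumes "h \<ge> 0" "l > 0"
  shows "(\<integral>\<^sup>+r. ennreal (h\<^sup>2 / r\<^sup>2 * (1 + 2 * l / r)) * indicator {h/2<..} r \<partial>lborel) \<le> ennreal (2 * h + 4 * l)"
proof (cases "h = 0")
  case False
  define F where "F r = - h\<^sup>2 / r - l * h\<^sup>2 / r\<^sup>2" for r :: real
  have lim: "(F \<longlongrightarrow> 0) at_top"
    unfolding F_def by real_asymp
  have "(\<integral>\<^sup>+r. ennreal (h\<^sup>2 / r\<^sup>2 * (1 + 2 * l / r)) * indicator {h/2<..} r \<partial>lborel) \<le>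
        (\<integral>\<^sup>+r. ennreal (h\<^sup>2 / r\<^sup>2 * (1 + 2 * l / r)) * indicator {h/2..} r \<partial>lborel)"
    by (intro nn_integral_mono) (auto simp: indicator_def)
  also have "\<dots> = ennreal (0 - F (h / 2))"
  proof (rule nn_integral_FTC_atLeast[OF _ _ _ lim])
    fix r assume "h / 2 \<le> r"
    then have r: "r > 0" using assms False by auto
    show "DERIV F r :> h\<^sup>2 / r\<^sup>2 * (1 + 2 * l / r)"
      unfolding F_def
      by (rule derivative_eq_intros refl | use r in \<open>simp; fail\<close>)+
         (use r in \<open>simp add: field_simps power2_eq_square\<close>)
    show "0 \<le> h\<^sup>2 / r\<^sup>2 * (1 + 2 * l / r)" using r assms by simp
  qed simp
  also have "0 - F (h / 2) = 2 * h + 4 * l"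
    using False by (simp add: F_def field_simps power2_eq_square)
  finally show ?thesis .
qed (use assms in simp)

text \<open>\<open>sqrt h * sqrt (r - h)\<close> is a lower bound for half the chord of the heavy
  line in a ball of radius \<open>r\<close> centred at height \<open>h\<close>. The singularity at
  \<open>r = h\<close> is integrable, and by scaling the value is the same for all
  \<open>h\<close>.\<close>

lemma nn_integral_inverse_sqrt:
  fixes h :: real
  assumes "h > 0"
  shows "(\<integral>\<^sup>+r. ennreal (1 / (sqrt h * sqrt (r - h))) * indicator {h..2 * h} r \<partial>lborel) = 2"
proof -
  have "((\<lambda>r. 1 / (sqrt h * sqrt (r - h))) has_integral
      2 * sqrt (2 * h - h) / sqrt h - 2 * sqrt (h - h) / sqrt h) {h..2 * h}"
  \<comment> \<open>The antiderivative is continuous up to \<open>r = h\<close> but not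
    differentiable there.\<close>
  proof (rule fundamental_theorem_of_calculus_interior)
    fix r assume "r \<in> {h<..<2 * h}"
    then have r: "r > h" by simp
    show "((\<lambda>r. 2 * sqrt (r - h) / sqrt h) has_vector_derivative 1 / (sqrt h * sqrt (r - h))) (at r)"
      unfolding has_real_derivative_iff_has_vector_derivative[symmetric]
      by (rule derivative_eq_intros refl | use r assms in \<open>simp; fail\<close>)+
         (use r assms in \<open>simp add: field_simps\<close>)
  qed (use assms in \<open>auto intro!: continuous_intros\<close>)
  then have "((\<lambda>r. 1 / (sqrt h * sqrt (r - h))) has_integral 2) {h..2 * h}"
    using assms by simp
  from nn_integral_has_integral_lebesgue[OF _ this] assms
  have "(\<integral>\<^sup>+r. ennreal (indicator {h..2 * h} r * (1 / (sqrt h * sqrt (r - h)))) \<partial>lborel) = ennreal 2"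
    by simp
  moreover have "ennreal (indicator {h..2 * h} r * (1 / (sqrt h * sqrt (r - h)))) =
     ennreal (1 / (sqrt h * sqrt (r - h))) * indicator {h..2 * h} r" for r
    by (auto simp: indicator_def)
  ultimately show ?thesis by simp
qed

section \<open>Pointwise bounds for the Jones integrand\<close>

definition jones :: "(real^2) measure \<Rightarrow> real^2 \<Rightarrow> real \<Rightarrow> ennreal" where
  "jones \<mu> x r = ennreal ((beta2 \<mu> (ball x r))\<^sup>2) / emeasure \<mu> (ball x r)"

lemma jones_stack_le:
  assumes "l > 0" "n > 0" "0 < S" "S \<le> (\<Sum>j<n. measure (seg l (h j)) (ball x r))"
    and "(beta2 (stack l n h) (ball x r))\<^sup>2 \<le> b"
  shows "jones (stack l n h) x r \<le> ennreal (b * n / S)"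
proof -
  let ?m = "\<Sum>j<n. measure (seg l (h j)) (ball x r)"
  have "jones (stack l n h) x r = ennreal ((beta2 (stack l n h) (ball x r))\<^sup>2 / (?m / n))"
    unfolding jones_def using assms
    by (subst emeasure_stack) (auto simp: divide_ennreal)
  also have "(beta2 (stack l n h) (ball x r))\<^sup>2 / (?m / n) \<le> b / (S / n)"
    using assms order.trans[OF zero_le_power2 assms(5)]
    by (intro frac_le divide_right_mono) auto
  finally show ?thesis by (simp add: ennreal_leI)
qed

text \<open>Test with the horizontal line through the centre: a segment at distance \<open>r\<close>
  or more from it misses the ball, and any other contributes at most \<open>r\<^sup>2\<close> times
  its mass.\<close>

lemma beta2_stack_le_1:
  assumes "l > 0" "n > 0" "r > 0"
  shows "(beta2 (stack l n h) (ball (pt a c) r))\<^sup>2 \<le> 1"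
proof -
  let ?m = "\<lambda>j. measure (seg l (h j)) (ball (pt a c) r)"
  have "?m j * (h j - c)\<^sup>2 \<le> ?m j * r\<^sup>2" for j
  proof (cases "r \<le> \<bar>h j - c\<bar>")
    case False
    then have "(h j - c)\<^sup>2 \<le> r\<^sup>2" by (simp add: abs_le_square_iff[symmetric])
    then show ?thesis by (intro mult_left_mono) auto
  qed (use measure_seg_ball_eq_0[OF assms(1)] in simp)
  then have "(\<Sum>j<n. ?m j * (h j - c)\<^sup>2) / (\<Sum>j<n. ?m j) / (4 * r\<^sup>2) \<le>
      (\<Sum>j<n. ?m j * r\<^sup>2) / (\<Sum>j<n. ?m j) / (4 * r\<^sup>2)"
    by (intro divide_right_mono sum_mono sum_nonneg) auto
  also have "\<dots> \<le> 1"
    using assms by (auto simp: sum_distrib_right[symmetric])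
  finally show ?thesis
    using beta2_stack_le[OF assms, of h "pt a c" c] by linarith
qed

text \<open>\<open>\<eta>\<close> is the mass of the line at height 0, which is represented by the indices \<open>N, \<dots>, n - 1\<close>
  of the stack; each of the other \<open>N\<close> lines carries mass \<open>1 / n\<close>.\<close>

locale heavy_stack =
  fixes l :: real and n N :: nat and h :: "nat \<Rightarrow> real"
  assumes l: "l > 0" and N: "N < n"
    and h_nonneg: "\<And>j. 0 \<le> h j" and h_heavy: "\<And>j. N \<le> j \<Longrightarrow> h j = 0"
begin

definition \<eta> :: real where "\<eta> = (real n - real N) / real n"

lemma \<eta>: "0 < \<eta>" "\<eta> \<le> 1"
  using N by (auto simp: \<eta>_def)

text \<open>Only the \<open>n * \<eta>\<close> copies at height 0 are counted; \<sigma> is at most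
  half the chord of the heavy line in the ball.\<close>

lemma heavy_mass_ge:
  assumes "0 \<le> a" "a \<le> l" "0 \<le> \<sigma>" "\<sigma>\<^sup>2 \<le> r\<^sup>2 - c\<^sup>2" "r > 0"
  shows "n * \<eta> * min 1 (\<sigma> / l) \<le> (\<Sum>j<n. measure (seg l (h j)) (ball (pt a c) r))"
proof -
  have "n * \<eta> * min 1 (\<sigma> / l) = (\<Sum>j\<in>{N..<n}. min 1 (\<sigma> / l))"
    using N by (simp add: \<eta>_def of_nat_diff)
  also have "\<dots> \<le> (\<Sum>j\<in>{N..<n}. measure (seg l (h j)) (ball (pt a c) r))"
    using assms l h_heavy by (intro sum_mono measure_seg_ball_ge) auto
  also have "\<dots> \<le> (\<Sum>j<n. measure (seg l (h j)) (ball (pt a c) r))"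
    by (intro sum_mono2) auto
  finally show ?thesis .
qed

text \<open>For \<open>r \<ge> 2 * c\<close> half the heavy chord is at least \<open>r / 2\<close>,
  so the ball has mass at least \<open>\<eta> * p\<close>. The line at height 0 is the competitor.
  The mass is divided by twice, in the beta number and in the integrand: hence
  \<open>\<eta>\<^sup>2\<close>, while one factor \<open>p\<close> cancels against the light
  mass.\<close>

lemma jones_far_le:
  assumes a: "0 \<le> a" "a \<le> l" and c: "0 \<le> c" "2 * c \<le> r" and r: "0 < r"
  shows "jones (stack l n h) (pt a c) r \<le>
    (\<Sum>j<n. ennreal (1 / (\<eta>\<^sup>2 * n)) *
      (ennreal ((h j)\<^sup>2 / r\<^sup>2 * (1 + 2 * l / r)) * indicator {h j / 2<..} r))"
proof -
  let ?m = "\<lambda>j. measure (seg l (h j)) (ball (pt a c) r)"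
  define p where "p = min 1 (r / 2 / l)"
  define S where "S = n * \<eta> * p"
  have p: "p > 0" "1 / p \<le> 1 + 2 * l / r"
    using r l by (auto simp: p_def min_def field_simps)
  have S: "S > 0" using p \<eta> N by (simp add: S_def)
  have "c\<^sup>2 \<le> (r / 2)\<^sup>2" using c by (intro power_mono) auto
  then have "(r / 2)\<^sup>2 \<le> r\<^sup>2 - c\<^sup>2" by (simp add: power_divide) (use zero_le_power2[of r] in linarith)
  then have mass: "S \<le> (\<Sum>j<n. ?m j)"
    unfolding S_def p_def using a r by (intro heavy_mass_ge) auto
  have m_le: "?m j * (h j)\<^sup>2 \<le> 4 * p * (h j)\<^sup>2 * indicator {h j / 2<..} r" for j
  proof (cases "h j / 2 < r")
    case True
    have "?m j \<le> min 1 (2 * r / l)" using l r by (intro measure_seg_ball_le)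
    \<comment> \<open>Full length \<open>2 * r\<close> against the guaranteed \<open>r / 2\<close>
      accounts for the 4.\<close>
    also have "\<dots> \<le> 4 * p" using l r by (auto simp: p_def min_def field_simps)
    finally show ?thesis using True by (simp add: mult_right_mono)
  next
    case False
    \<comment> \<open>Here \<open>h j \<ge> 2 * r\<close> and \<open>c \<le> r / 2\<close>, so
      segment \<open>j\<close> misses the ball.\<close>
    then have "r \<le> \<bar>h j - c\<bar>" using c by linarith
    then show ?thesis using measure_seg_ball_eq_0[OF l] False by simp
  qed
  have "(beta2 (stack l n h) (ball (pt a c) r))\<^sup>2 \<le>
      (\<Sum>j<n. ?m j * (h j - 0)\<^sup>2) / (\<Sum>j<n. ?m j) / (4 * r\<^sup>2)"
    using l N r by (intro beta2_stack_le) auto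
  also have "\<dots> \<le> (\<Sum>j<n. 4 * p * (h j)\<^sup>2 * indicator {h j / 2<..} r) / S / (4 * r\<^sup>2)"
    using S mass m_le p by (intro divide_right_mono frac_le sum_mono sum_nonneg) auto
  finally have "jones (stack l n h) (pt a c) r \<le>
      ennreal ((\<Sum>j<n. 4 * p * (h j)\<^sup>2 * indicator {h j / 2<..} r) / S / (4 * r\<^sup>2) * n / S)"
    using l N S mass by (intro jones_stack_le) auto
  also have "(\<Sum>j<n. 4 * p * (h j)\<^sup>2 * indicator {h j / 2<..} r) / S / (4 * r\<^sup>2) * n / S =
     (\<Sum>j<n. 4 * p * (h j)\<^sup>2 * indicator {h j / 2<..} r * (n / (S * S * (4 * r\<^sup>2))))"
    unfolding sum_distrib_right[symmetric] by (simp add: mult_ac)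
  also have "\<dots> \<le> (\<Sum>j<n. 1 / (\<eta>\<^sup>2 * n) * ((h j)\<^sup>2 / r\<^sup>2 * (1 + 2 * l / r) * indicator {h j / 2<..} r))"
  proof (intro sum_mono)
    fix j
    have "4 * p * (h j)\<^sup>2 * indicator {h j / 2<..} r * (n / (S * S * (4 * r\<^sup>2))) =
      1 / (\<eta>\<^sup>2 * n) * ((h j)\<^sup>2 / r\<^sup>2 * (1 / p) * indicator {h j / 2<..} r)"
      using p r N \<eta> by (simp add: S_def field_simps power2_eq_square)
    also have "\<dots> \<le> 1 / (\<eta>\<^sup>2 * n) * ((h j)\<^sup>2 / r\<^sup>2 * (1 + 2 * l / r) * indicator {h j / 2<..} r)"
      using p by (intro mult_left_mono mult_right_mono) auto
    finally show "4 * p * (h j)\<^sup>2 * indicator {h j / 2<..} r * (n / (S * S * (4 * r\<^sup>2))) \<le> \<dots>" .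
  qed
  also have "ennreal \<dots> = (\<Sum>j<n. ennreal (1 / (\<eta>\<^sup>2 * n) * ((h j)\<^sup>2 / r\<^sup>2 * (1 + 2 * l / r) * indicator {h j / 2<..} r)))"
    using l r by (intro sum_ennreal[symmetric]) auto
  also have "\<dots> = (\<Sum>j<n. ennreal (1 / (\<eta>\<^sup>2 * n)) *
      (ennreal ((h j)\<^sup>2 / r\<^sup>2 * (1 + 2 * l / r)) * indicator {h j / 2<..} r))"
    using l r by (intro sum.cong refl) (auto simp: ennreal_mult[symmetric] indicator_def)
  finally show ?thesis by (simp add: ennreal_leI)
qed

text \<open>Each of the \<open>n\<close> integrals is at most \<open>6 * l\<close> and has weight
  \<open>1 / (\<eta>\<^sup>2 * n)\<close>: the number of segments cancels.\<close>

lemma nn_integral_far_le: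
  assumes h_le: "\<And>j. h j \<le> l"
  shows "(\<integral>\<^sup>+r. (\<Sum>j<n. ennreal (1 / (\<eta>\<^sup>2 * n)) *
      (ennreal ((h j)\<^sup>2 / r\<^sup>2 * (1 + 2 * l / r)) * indicator {h j / 2<..} r)) \<partial>lborel) \<le> ennreal (6 * l / \<eta>\<^sup>2)"
proof -
  have "(\<integral>\<^sup>+r. (\<Sum>j<n. ennreal (1 / (\<eta>\<^sup>2 * n)) *
      (ennreal ((h j)\<^sup>2 / r\<^sup>2 * (1 + 2 * l / r)) * indicator {h j / 2<..} r)) \<partial>lborel) =
    (\<Sum>j<n. ennreal (1 / (\<eta>\<^sup>2 * n)) *
      (\<integral>\<^sup>+r. ennreal ((h j)\<^sup>2 / r\<^sup>2 * (1 + 2 * l / r)) * indicator {h j / 2<..} r \<partial>lborel))"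
    by (subst nn_integral_sum) (auto simp: nn_integral_cmult)
  also have "\<dots> \<le> (\<Sum>j<n. ennreal (1 / (\<eta>\<^sup>2 * n)) * ennreal (6 * l))"
  proof (intro sum_mono mult_left_mono)
    fix j
    show "(\<integral>\<^sup>+r. ennreal ((h j)\<^sup>2 / r\<^sup>2 * (1 + 2 * l / r)) * indicator {h j / 2<..} r \<partial>lborel) \<le> ennreal (6 * l)"
      using h_le[of j] by (intro order.trans[OF nn_integral_inverse_power_tail] ennreal_leI h_nonneg l) auto
  qed auto
  also have "\<dots> = (\<Sum>j<n. ennreal (1 / (\<eta>\<^sup>2 * n) * (6 * l)))"
    using l by (intro sum.cong refl ennreal_mult[symmetric]) auto
  also have "\<dots> = ennreal (\<Sum>j<n. 1 / (\<eta>\<^sup>2 * n) * (6 * l))"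
    using l by (intro sum_ennreal) auto
  also have "(\<Sum>j<n. 1 / (\<eta>\<^sup>2 * n) * (6 * l)) = 6 * l / \<eta>\<^sup>2"
    using N by simp
  finally show ?thesis .
qed

text \<open>The heavy chord is bounded by
  \<open>r\<^sup>2 - c\<^sup>2 = (r + c) * (r - c) \<ge> c * (r - c)\<close>. The assumption
  \<open>2 * c \<le> l\<close> keeps the resulting \<sigma> below \<open>l\<close>, so the minimum
  in \<open>heavy_mass_ge\<close> is \<open>\<sigma> / l\<close>.\<close>

lemma jones_near_le:
  assumes a: "0 \<le> a" "a \<le> l" and c: "0 < c" "2 * c \<le> l" and r: "c < r" "r \<le> 2 * c"
  shows "jones (stack l n h) (pt a c) r \<le> ennreal (l / \<eta>) * ennreal (1 / (sqrt c * sqrt (r - c)))"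
proof -
  let ?\<sigma> = "sqrt c * sqrt (r - c)"
  have sq: "?\<sigma>\<^sup>2 = c * (r - c)" using c r by (simp add: power_mult_distrib)
  have "c * (r - c) \<le> (r + c) * (r - c)" using c r by (intro mult_right_mono) auto
  then have le: "?\<sigma>\<^sup>2 \<le> r\<^sup>2 - c\<^sup>2" unfolding sq by (simp add: power2_eq_square algebra_simps)
  have "?\<sigma>\<^sup>2 \<le> l\<^sup>2"
    unfolding sq unfolding power2_eq_square using c r by (intro mult_mono) auto
  then have "?\<sigma> \<le> l" by (rule power2_le_imp_le) (use l in simp)
  then have "n * \<eta> * min 1 (?\<sigma> / l) = n * \<eta> * (?\<sigma> / l)" using l by simp
  moreover have "n * \<eta> * min 1 (?\<sigma> / l) \<le> (\<Sum>j<n. measure (seg l (h j)) (ball (pt a c) r))"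
    using a c r le by (intro heavy_mass_ge) auto
  ultimately have "jones (stack l n h) (pt a c) r \<le> ennreal (1 * real n / (n * \<eta> * (?\<sigma> / l)))"
    using l N c r \<eta> by (intro jones_stack_le beta2_stack_le_1) auto
  also have "1 * real n / (n * \<eta> * (?\<sigma> / l)) = l / \<eta> * (1 / ?\<sigma>)"
    using N by (simp add: field_simps)
  finally show ?thesis using l \<eta> c r by (simp add: ennreal_mult[symmetric])
qed

text \<open>Only the segment of the centre is counted, at the price of a factor \<open>n\<close>.
  This is affordable on a range of radii of relative length \<open>1 / n\<close>.\<close>

lemma jones_own_le:
  assumes a: "0 \<le> a" "a \<le> l" and k: "k < n" and r: "0 < r" "r \<le> l"
  shows "jones (stack l n h) (pt a (h k)) r \<le> ennreal (n * l / r)"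
proof -
  let ?m = "\<lambda>j. measure (seg l (h j)) (ball (pt a (h k)) r)"
  have "r / l = min 1 (r / l)" using l r by simp
  also have "\<dots> \<le> ?m k" using l a r by (intro measure_seg_ball_ge) auto
  also have "\<dots> \<le> (\<Sum>j<n. ?m j)" using k by (intro member_le_sum) auto
  finally have "jones (stack l n h) (pt a (h k)) r \<le> ennreal (1 * real n / (r / l))"
    using l N r by (intro jones_stack_le beta2_stack_le_1) auto
  then show ?thesis by (simp add: field_simps)
qed

text \<open>All mass in the ball lies on the line at height \<open>c\<close>, which makes the beta
  number vanish.\<close>

lemma jones_isolated_eq_0:
  assumes "r > 0" and sep: "\<And>j. j < n \<Longrightarrow> h j \<noteq> c \<Longrightarrow> r \<le> \<bar>h j - c\<bar>"
  shows "jones (stack l n h) (pt a c) r = 0"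
proof -
  have "measure (seg l (h j)) (ball (pt a c) r) * (h j - c)\<^sup>2 = 0" if "j < n" for j
    using measure_seg_ball_eq_0[OF l sep[OF that]] by (cases "h j = c") auto
  then have "(\<Sum>j<n. measure (seg l (h j)) (ball (pt a c) r) * (h j - c)\<^sup>2) = 0"
    by (intro sum.neutral) auto
  then have "(beta2 (stack l n h) (ball (pt a c) r))\<^sup>2 \<le> 0"
    using beta2_stack_le[OF l _ assms(1), of n h "pt a c" c] N by simp
  then show ?thesis by (simp add: jones_def)
qed

section \<open>The Jones integral at a point of the stack\<close>

text \<open>For a light centre of height \<open>c\<close> the radii split at
  \<open>(1 - 1 / n) * c\<close>, \<open>c\<close> and \<open>2 * c\<close>: the integrand vanishes
  first, then the bounds by the own segment, the heavy chord and the far estimate take over. The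
  separation hypothesis makes the second range so short, of length \<open>c / n\<close>, that the
  factor \<open>n\<close> is absorbed.\<close>

lemma nn_integral_jones_le:
  assumes n: "n \<ge> 2" and h_le: "\<And>j. 2 * h j \<le> l" and h_pos: "\<And>k. k < N \<Longrightarrow> 0 < h k"
    and sep: "\<And>j k. k < N \<Longrightarrow> j < n \<Longrightarrow> j \<noteq> k \<Longrightarrow> (1 - 1 / n) * h k \<le> \<bar>h j - h k\<bar>"
    and a: "0 \<le> a" "a \<le> l" and k: "k < n"
  shows "(\<integral>\<^sup>+r\<in>{0<..}. jones (stack l n h) (pt a (h k)) r \<partial>lborel) \<le> ennreal (10 * l / \<eta>\<^sup>2)"
proof -
  let ?J = "jones (stack l n h) (pt a (h k))"
  define G where "G r = (\<Sum>j<n. ennreal (1 / (\<eta>\<^sup>2 * n)) *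
      (ennreal ((h j)\<^sup>2 / r\<^sup>2 * (1 + 2 * l / r)) * indicator {h j / 2<..} r))" for r
  have [measurable]: "G \<in> borel_measurable borel"
    unfolding G_def by measurable
  have "h j \<le> l" for j
    using h_le[of j] h_nonneg[of j] by linarith
  then have G: "(\<integral>\<^sup>+r. G r \<partial>lborel) \<le> ennreal (6 * l / \<eta>\<^sup>2)"
    unfolding G_def by (rule nn_integral_far_le)
  have far: "?J r \<le> G r" if "0 < r" "2 * h k \<le> r" for r
    unfolding G_def using a that h_nonneg by (intro jones_far_le)
  have "(\<integral>\<^sup>+r\<in>{0<..}. ?J r \<partial>lborel) \<le> ennreal (2 * l + 2 * l / \<eta> + 6 * l / \<eta>\<^sup>2)"
  proof (cases "k < N")
    \<comment> \<open>At height 0 every positive radius is in the far range.\<close>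
    case False
    then have "(\<integral>\<^sup>+r\<in>{0<..}. ?J r \<partial>lborel) \<le> (\<integral>\<^sup>+r. G r \<partial>lborel)"
      using h_heavy far by (intro nn_integral_mono) (auto simp: indicator_def)
    also have "\<dots> \<le> ennreal (2 * l + 2 * l / \<eta> + 6 * l / \<eta>\<^sup>2)"
      using l \<eta> by (intro order.trans[OF G] ennreal_leI) auto
    finally show ?thesis .
  next
    case True
    define c where "c = h k"
    have c: "c > 0" "2 * c \<le> l" using h_pos[OF True] h_le by (auto simp: c_def)
    define A where "A = {(1 - 1 / n) * c<..c}"
    \<comment> \<open>Keeps \<open>r\<close> above \<open>c / 2\<close> on \<open>A\<close>, so that
      \<open>1 / r\<close> can be replaced by \<open>2 / c\<close>.\<close>
    have half: "c / 2 \<le> (1 - 1 / n) * c"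
      using n c by (simp add: field_simps)
    have bound: "?J r * indicator {0<..} r \<le> ennreal (2 * n * l / c) * indicator A r
        + ennreal (l / \<eta>) * (ennreal (1 / (sqrt c * sqrt (r - c))) * indicator {c..2 * c} r) + G r" for r
    proof -
      consider "r \<le> 0" | "0 < r" "r \<le> (1 - 1 / n) * c" | "r \<in> A" | "c < r" "r \<le> 2 * c" | "2 * c < r"
        unfolding A_def by fastforce
      then show ?thesis
      proof cases
        case 2
        have "?J r = 0"
        proof (rule jones_isolated_eq_0)
          fix j assume "j < n" "h j \<noteq> h k"
          then show "r \<le> \<bar>h j - h k\<bar>"
            using sep[OF True, of j] 2 unfolding c_def by (cases "j = k") auto
        qed fact
        then show ?thesis by simp
      next
        case 3
        then have r: "c / 2 < r" "r \<le> c" using half unfolding A_def greaterThanAtMost_iff by linarith+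
        have "?J r \<le> ennreal (n * l / r)"
          using a k r c by (intro jones_own_le) auto
        also have "n * l / r \<le> n * l / (c / 2)"
          using r c l by (intro divide_left_mono) auto
        also have "n * l / (c / 2) = 2 * n * l / c" by simp
        finally have "?J r \<le> ennreal (2 * n * l / c)" by (simp add: ennreal_leI)
        then have "?J r * indicator {0<..} r \<le> ennreal (2 * n * l / c) * indicator A r"
          using 3 r c by simp
        then show ?thesis
          by (intro add_increasing2 zero_le)
      next
        case 4
        then have "?J r \<le> ennreal (l / \<eta>) * ennreal (1 / (sqrt c * sqrt (r - c)))"
          unfolding c_def using a c by (intro jones_near_le) (auto simp: c_def)
        then have "?J r * indicator {0<..} r \<le>
            ennreal (l / \<eta>) * (ennreal (1 / (sqrt c * sqrt (r - c))) * indicator {c..2 * c} r)"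
          using 4 c by simp
        then show ?thesis
          by (intro add_increasing2[OF zero_le] add_increasing[OF zero_le])
      next
        case 5
        then have "?J r * indicator {0<..} r \<le> G r"
          using far[of r] c by (simp add: c_def)
        then show ?thesis
          by (intro add_increasing[OF zero_le])
      qed auto
    qed
    have "(\<integral>\<^sup>+r. ennreal (2 * n * l / c) * indicator A r \<partial>lborel) = ennreal (2 * n * l / c) * ennreal (c / n)"
      using n c by (subst nn_integral_cmult_indicator) (auto simp: A_def algebra_simps)
    also have "\<dots> = ennreal (2 * l)"
      using n c l by (simp add: ennreal_mult[symmetric])
    finally have A: "(\<integral>\<^sup>+r. ennreal (2 * n * l / c) * indicator A r \<partial>lborel) = ennreal (2 * l)" .
    have B: "(\<integral>\<^sup>+r. ennreal (l / \<eta>) * (ennreal (1 / (sqrt c * sqrt (r - c))) * indicator {c..2 * c} r) \<partial>lborel)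
        = ennreal (2 * l / \<eta>)"
    proof (subst nn_integral_cmult)
      have "ennreal (2 * l / \<eta>) = ennreal (l / \<eta> * 2)" by (simp add: mult.commute)
      also have "\<dots> = ennreal (l / \<eta>) * 2" using l \<eta> by (subst ennreal_mult) auto
      finally show "ennreal (l / \<eta>) *
          (\<integral>\<^sup>+r. ennreal (1 / (sqrt c * sqrt (r - c))) * indicator {c..2 * c} r \<partial>lborel) = ennreal (2 * l / \<eta>)"
        by (simp only: nn_integral_inverse_sqrt[OF c(1)])
    qed simp
    \<comment> \<open>\<open>?J\<close> enters by monotonicity alone; only the measurable majorant
      is split into a sum.\<close>
    have "(\<integral>\<^sup>+r\<in>{0<..}. ?J r \<partial>lborel) \<le> (\<integral>\<^sup>+r. ennreal (2 * n * l / c) * indicator A r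
        + ennreal (l / \<eta>) * (ennreal (1 / (sqrt c * sqrt (r - c))) * indicator {c..2 * c} r) + G r \<partial>lborel)"
      by (intro nn_integral_mono bound)
    also have "\<dots> = ennreal (2 * l) + ennreal (2 * l / \<eta>) + (\<integral>\<^sup>+r. G r \<partial>lborel)"
      unfolding A[symmetric] B[symmetric]
      by (subst nn_integral_add, (simp add: A_def; fail), (simp; fail))+ simp
    also have "\<dots> \<le> ennreal (2 * l) + ennreal (2 * l / \<eta>) + ennreal (6 * l / \<eta>\<^sup>2)"
      by (intro add_left_mono G)
    also have "\<dots> = ennreal (2 * l + 2 * l / \<eta> + 6 * l / \<eta>\<^sup>2)"
      using l \<eta> by (simp add: ennreal_plus[symmetric] del: ennreal_plus)
    finally show ?thesis .
  qed
  also have "2 * l + 2 * l / \<eta> + 6 * l / \<eta>\<^sup>2 \<le> 10 * l / \<eta>\<^sup>2"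
  proof -
    have sq: "\<eta>\<^sup>2 \<le> \<eta>" using \<eta> by (simp add: power2_eq_square mult_left_le_one_le)
    have "l \<le> l / \<eta>\<^sup>2" "l / \<eta> \<le> l / \<eta>\<^sup>2"
      using l \<eta> sq frac_le[of l l "\<eta>\<^sup>2" 1] frac_le[of l l "\<eta>\<^sup>2" \<eta>] by auto
    moreover have "2 * l / \<eta> = 2 * (l / \<eta>)" "6 * l / \<eta>\<^sup>2 = 6 * (l / \<eta>\<^sup>2)"
        "10 * l / \<eta>\<^sup>2 = 10 * (l / \<eta>\<^sup>2)" by simp_all
    ultimately show ?thesis by linarith
  qed
  finally show ?thesis by (simp add: ennreal_leI)
qed

section \<open>Mass of sets of Hausdorff measure at most 1\<close>

text \<open>Cover \<Gamma> by sets of diameter at most \<delta> with diameters summing to less than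
  2. Off the heavy line, whose mass is \<eta>, each meets at most one segment because the gaps
  exceed \<delta>, and there it carries at most \<open>2 / (n * l)\<close> times its
  diameter.\<close>

lemma outer_measure_stack_le:
  assumes \<delta>: "\<delta> > 0" and sep: "\<And>i j. i < N \<Longrightarrow> j < n \<Longrightarrow> j \<noteq> i \<Longrightarrow> \<delta> < \<bar>h j - h i\<bar>"
    and \<Gamma>: "hausdorff1 \<Gamma> \<le> 1"
  shows "outer_measure_of (stack l n h) \<Gamma> \<le> ennreal (\<eta> + 4 / (n * l))"
proof -
  let ?\<mu> = "stack l n h"
  have "hausdorff1_pre \<delta> \<Gamma> \<le> hausdorff1 \<Gamma>"
    unfolding hausdorff1_def using \<delta> by (intro SUP_upper) auto
  \<comment> \<open>The infimum need not be attained, but any bound above 1 yields an actual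
    cover.\<close>
  also have "\<dots> < 2"
    using \<Gamma> by (rule order.strict_trans1) simp
  finally obtain E where E: "\<Gamma> \<subseteq> (\<Union>i. E i)" "\<And>i. bounded (E i)" "\<And>i. diameter (E i) \<le> \<delta>"
      and sum: "(\<Sum>i. ennreal (diameter (E i))) < 2"
    unfolding hausdorff1_pre_def INF_less_iff by auto
  define Z where "Z = {y :: real^2. y $ 2 = 0}"
  \<comment> \<open>Closures are Borel and keep the diameter. The heavy line is removed because it
    is charged its whole mass \<eta> separately.\<close>
  define C where "C i = closure (E i) - Z" for i
  have "closed Z"
    unfolding Z_def by (intro closed_Collect_eq continuous_intros)
  then have [measurable]: "Z \<in> sets borel" "C i \<in> sets borel" for i
    by (auto simp: C_def)
  \<comment> \<open>Index \<open>N\<close> lies on the heavy line, so its gap to \<open>j\<close>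
    separates \<open>h j\<close> from 0.\<close>
  have h_ne: "h j \<noteq> 0" if "j < N" for j
    using sep[OF that, of N] that N h_heavy[of N] \<delta> by auto
  have "(\<Sum>j<n. measure (seg l (h j)) Z) \<le> (\<Sum>j<n. if j < N then 0 else 1)"
    using h_ne l by (intro sum_mono) (auto simp: measure_seg_le_1 Z_def[symmetric] intro!: measure_seg_eq_0 eq_refl, simp add: Z_def)
  also have "\<dots> = real (card {N..<n})"
  proof -
    have "{..<n} \<inter> - {j. j < N} = {N..<n}" by auto
    then show ?thesis by (simp add: sum.If_cases)
  qed
  also have "\<dots> = n * \<eta>"
    using N by (simp add: \<eta>_def of_nat_diff)
  finally have Z: "emeasure ?\<mu> Z \<le> ennreal \<eta>"
    using l N by (subst emeasure_stack) (auto intro!: ennreal_leI simp: field_simps)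
  have C: "emeasure ?\<mu> (C i) \<le> ennreal (2 / (n * l)) * ennreal (diameter (E i))" for i
  proof -
    let ?d = "diameter (E i)"
    have d: "0 \<le> ?d" using E by (intro diameter_ge_0)
    have close: "\<bar>t - t'\<bar> \<le> ?d \<and> \<bar>s - s'\<bar> \<le> ?d" if "pt t s \<in> C i" "pt t' s' \<in> C i" for t s t' s'
    proof -
      have "dist (pt t s) (pt t' s') \<le> ?d"
        using that E(2)[of i] unfolding C_def
        by (subst diameter_closure[symmetric]) (auto intro: diameter_bounded_bound)
      moreover have "\<bar>t - t'\<bar> \<le> dist (pt t s) (pt t' s')" "\<bar>s - s'\<bar> \<le> dist (pt t s) (pt t' s')"
        unfolding dist_pt by (auto intro: real_le_rsqrt)
      ultimately show ?thesis by linarith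
    qed
    have "(\<Sum>j<n. measure (seg l (h j)) (C i)) \<le> 2 * ?d / l"
    proof (cases "\<exists>j<n. \<exists>t. pt t (h j) \<in> C i")
      case True
      then obtain j t where j: "j < n" "pt t (h j) \<in> C i" by auto
      then have "h j \<noteq> 0" by (auto simp: C_def Z_def)
      then have "j < N" using h_heavy[of j] by force
      have "measure (seg l (h j')) (C i) = 0" if "j' < n" "j' \<noteq> j" for j'
      proof (rule measure_seg_eq_0)
        fix t' show "pt t' (h j') \<notin> C i"
          using close[OF _ j(2), of t' "h j'"] sep[OF \<open>j < N\<close> that] E(3)[of i] by auto
      qed (use l in auto)
      then have "(\<Sum>j'<n. measure (seg l (h j')) (C i)) = measure (seg l (h j)) (C i)"
        using j by (subst sum.remove[of _ j]) auto
      \<comment> \<open>Around the known point at \<open>t\<close> the trace lies in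
        \<open>[t - ?d, t + ?d]\<close>; hence the factor 2.\<close>
      also have "\<dots> \<le> 2 * ?d / l"
        using l d close[OF _ j(2)]
        by (intro measure_seg_le[where c = "t - ?d"]) (auto simp: abs_le_iff, fastforce+)
      finally show ?thesis .
    next
      case False
      then have "measure (seg l (h j)) (C i) = 0" if "j < n" for j
        using l that by (intro measure_seg_eq_0) auto
      then show ?thesis using d l by simp
    qed
    then have "(\<Sum>j<n. measure (seg l (h j)) (C i)) / n \<le> 2 * ?d / l / n"
      by (intro divide_right_mono) auto
    then have "emeasure ?\<mu> (C i) \<le> ennreal (2 / (n * l) * ?d)"
      using l N by (subst emeasure_stack) (auto intro!: ennreal_leI simp: field_simps)
    then show ?thesis
      using d l by (simp add: ennreal_mult[symmetric])
  qed
  have "\<Gamma> \<subseteq> Z \<union> (\<Union>i. C i)"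
    using E(1) closure_subset unfolding C_def by blast
  then have "outer_measure_of ?\<mu> \<Gamma> \<le> emeasure ?\<mu> (Z \<union> (\<Union>i. C i))"
    unfolding outer_measure_of_def by (intro INF_lower) auto
  also have "\<dots> \<le> emeasure ?\<mu> Z + emeasure ?\<mu> (\<Union>i. C i)"
    by (intro emeasure_subadditive) auto
  also have "\<dots> \<le> ennreal \<eta> + (\<Sum>i. emeasure ?\<mu> (C i))"
    by (intro add_mono Z emeasure_subadditive_countably) auto
  also have "(\<Sum>i. emeasure ?\<mu> (C i)) \<le> (\<Sum>i. ennreal (2 / (n * l)) * ennreal (diameter (E i)))"
    by (intro suminf_le C) auto
  also have "\<dots> = ennreal (2 / (n * l)) * (\<Sum>i. ennreal (diameter (E i)))"
    by simp
  also have "\<dots> \<le> ennreal (2 / (n * l)) * ennreal 2"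
    using sum by (intro mult_left_mono) auto
  also have "\<dots> = ennreal (4 / (n * l))"
    using l by (subst ennreal_mult[symmetric]) auto
  also have "ennreal \<eta> + \<dots> = ennreal (\<eta> + 4 / (n * l))"
    using l \<eta> by simp
  finally show ?thesis by (simp add: add_left_mono)
qed

end

section \<open>Lacunary heights and the choice of parameters\<close>

text \<open>Heights drop by a factor of at least \<open>n\<close> from one light index to the next.
  A lower height is thus at most \<open>h k / n\<close>, the worst case; a higher one is at least
  \<open>n * h k \<ge> 2 * h k\<close>, at distance at least \<open>h k\<close>.\<close>

lemma lacunary_separated:
  fixes l :: real
  assumes l: "l > 0" and n: "n \<ge> 2"
    and h: "\<And>j. h j = (if j < N then l / real n ^ Suc j else 0)"
    and k: "k < N" and jk: "j \<noteq> k"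
  shows "(1 - 1 / n) * h k \<le> \<bar>h j - h k\<bar>"
proof -
  have step: "h j * n \<le> h i" if "i < j" "j < N" for i j
  proof -
    have "l / real n ^ j \<le> l / real n ^ Suc i"
      using l n that by (intro divide_left_mono power_increasing) auto
    then show ?thesis using n that by (simp add: h)
  qed
  have hk: "h k > 0" using k l n by (simp add: h)
  consider "j < k" | "k < j" "j < N" | "N \<le> j" using jk k by linarith
  then show ?thesis
  proof cases
    case 1
    have "h k * 2 \<le> h k * n" using hk n by (intro mult_left_mono) auto
    also have "\<dots> \<le> h j" using step[OF 1 k] .
    finally have "h k \<le> h j - h k" by simp
    moreover have "(1 - 1 / n) * h k \<le> 1 * h k" using hk by (intro mult_right_mono) auto
    ultimately show ?thesis by linarith
  next
    case 2
    then have "h j \<le> h k / n" using step[of k j] n by (simp add: field_simps)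
    then have "(1 - 1 / n) * h k \<le> h k - h j" by (simp add: algebra_simps)
    then show ?thesis by linarith
  next
    case 3
    then show ?thesis using hk n by (simp add: h field_simps)
  qed
qed

theorem theorem1p4:
  fixes \<epsilon> :: real
  assumes "\<epsilon> > 0"
  shows "\<exists>\<mu> :: (real^2) measure.
    radon_measure \<mu> \<and> prob_space \<mu> \<and> spt \<mu> \<subseteq> {x. \<forall>i. 0 \<le> x $ i \<and> x $ i \<le> 1} \<and>
    (\<forall>x\<in>spt \<mu>.
       (\<integral>\<^sup>+ r\<in>{0<..}. (ennreal ((beta2 \<mu> (ball x r))\<^sup>2) / emeasure \<mu> (ball x r)) \<partial>lborel)
         \<le> ennreal \<epsilon>) \<and>
    (\<forall>\<Gamma>. hausdorff1_measurable \<Gamma> \<and> hausdorff1 \<Gamma> \<le> 1 \<longrightarrow>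
       outer_measure_of \<mu> \<Gamma> \<le> ennreal \<epsilon>)"
proof -
  \<comment> \<open>The cap at 1 gives \<open>P \<ge> 2\<close> and \<open>l \<le> 1\<close>; the
    latter places the stack in the unit square.\<close>
  define e where "e = min \<epsilon> 1"
  have e: "0 < e" "e \<le> 1" "e \<le> \<epsilon>" using assms by (auto simp: e_def)
  \<comment> \<open>\<open>1 / P\<close> will be the heavy mass \<eta>, at most
    \<open>e / 2\<close>.\<close>
  obtain P :: nat where P: "2 / e \<le> P" using real_arch_simple by blast
  have "2 \<le> 2 / e" using e by (simp add: field_simps)
  then have P2: "P \<ge> 2" using P by linarith
  \<comment> \<open>Solves \<open>10 * l / \<eta>\<^sup>2 = e\<close> for
    \<open>\<eta> = 1 / P\<close>.\<close>
  define l where "l = e / (10 * P\<^sup>2)"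
  have l: "l > 0" using e P2 by (simp add: l_def)
  \<comment> \<open>Makes the light part \<open>4 / (n * l)\<close> at most \<open>e / 2\<close>,
    since \<open>n \<ge> K\<close>.\<close>
  obtain K :: nat where K: "8 / (l * e) \<le> K" using real_arch_simple by blast
  have "8 / (l * e) > 0" using l e by simp
  then have K0: "K > 0" using K by linarith
  \<comment> \<open>With \<open>K\<close> of the \<open>P * K\<close> indices on the heavy line,
    \<open>\<eta> = 1 / P\<close> whatever \<open>K\<close> is; so \<open>l\<close> can be fixed
    before \<open>n\<close>.\<close>
  define n where "n = P * K"
  define N where "N = n - K"
  \<comment> \<open>The exponent starts at 1, so that \<open>2 * h j \<le> l\<close> already for
    \<open>j = 0\<close>.\<close>
  define h where "h j = (if j < N then l / real n ^ Suc j else 0)" for j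
  have nK: "n \<ge> K" "n \<ge> 2" using P2 K0 mult_le_mono[of 2 P 1 K] by (auto simp: n_def)
  interpret heavy_stack l n N h
    using l nK K0 by unfold_locales (auto simp: N_def h_def)
  have \<eta>: "\<eta> = 1 / P"
    unfolding \<eta>_def using nK K0 P2 by (simp add: N_def of_nat_diff) (simp add: n_def)
  have "10 * l / \<eta>\<^sup>2 = e"
    using P2 by (simp add: \<eta> l_def field_simps)
  have h_le: "2 * h j \<le> l" for j
  proof -
    have "(2::real) \<le> real n ^ 1" using nK by simp
    also have "\<dots> \<le> real n ^ Suc j" using nK by (intro power_increasing) auto
    finally have "l / real n ^ Suc j \<le> l / 2" using l by (intro divide_left_mono) auto
    then have "2 * (l / real n ^ Suc j) \<le> l" by linarith
    then show ?thesis unfolding h_def using l by (simp only: split: if_split) simp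
  qed
  have h_pos: "0 < h k" if "k < N" for k
    using that l nK by (simp add: h_def)
  have sep: "(1 - 1 / n) * h k \<le> \<bar>h j - h k\<bar>" if "k < N" "j \<noteq> k" for j k
    using l nK(2) h_def that by (rule lacunary_separated)
  \<comment> \<open>The lowest light height is \<open>l / n ^ N\<close>, and gaps are at least half
    a light height; 3 in place of 2 makes the inequality strict.\<close>
  define \<delta> where "\<delta> = l / (3 * real n ^ N)"
  have sep': "\<delta> < \<bar>h j - h k\<bar>" if "k < N" "j \<noteq> k" for j k
  proof -
    have "\<delta> < 1 / 2 * (l / real n ^ N)" using l nK by (simp add: \<delta>_def field_simps)
    also have "\<dots> \<le> (1 - 1 / n) * h k"
    proof (rule mult_mono)
      show "1 / 2 \<le> 1 - 1 / real n" using nK by (simp add: field_simps)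
      have "l / real n ^ N \<le> l / real n ^ Suc k"
        using that l nK by (intro divide_left_mono power_increasing) auto
      then show "l / real n ^ N \<le> h k" using that by (simp add: h_def)
    qed (use l nK in auto)
    also have "\<dots> \<le> \<bar>h j - h k\<bar>" using that by (rule sep)
    finally show ?thesis .
  qed
  let ?\<mu> = "stack l n h"
  have spt: "spt ?\<mu> \<subseteq> {pt a (h j) |a j. 0 \<le> a \<and> a \<le> l \<and> j < n}"
    using l nK by (intro spt_stack_subset) auto
  have "10 * (real P)\<^sup>2 \<ge> 1" using P2 one_le_power[of "real P" 2] by linarith
  then have "l \<le> 1" using e unfolding l_def by (intro divide_le_eq_1[THEN iffD2]) auto
  show ?thesis
  proof (intro exI[of _ ?\<mu>] conjI ballI allI impI)
    show prob: "prob_space ?\<mu>" using l nK by (intro prob_space_stack) auto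
    then show "radon_measure ?\<mu>"
      by (intro radon_measure_finite_borel) (auto simp: prob_space_def)
    have "0 \<le> h j \<and> h j \<le> 1" for j
      using h_le[of j] h_nonneg[of j] \<open>l \<le> 1\<close> by linarith
    then show "spt ?\<mu> \<subseteq> {x. \<forall>i. 0 \<le> x $ i \<and> x $ i \<le> 1}"
      using \<open>l \<le> 1\<close> by (intro order.trans[OF spt]) (auto simp: forall_2)
  next
    fix x assume "x \<in> spt ?\<mu>"
    then obtain a j where x: "x = pt a (h j)" "0 \<le> a" "a \<le> l" "j < n" using spt by auto
    have "(\<integral>\<^sup>+r\<in>{0<..}. jones ?\<mu> x r \<partial>lborel) \<le> ennreal (10 * l / \<eta>\<^sup>2)"
      unfolding x(1) using nK x h_le h_pos sep by (intro nn_integral_jones_le) auto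
    also have "\<dots> \<le> ennreal \<epsilon>" using e \<open>10 * l / \<eta>\<^sup>2 = e\<close> by (simp add: ennreal_leI)
    finally show "(\<integral>\<^sup>+ r\<in>{0<..}. (ennreal ((beta2 ?\<mu> (ball x r))\<^sup>2) / emeasure ?\<mu> (ball x r)) \<partial>lborel)
         \<le> ennreal \<epsilon>" unfolding jones_def .
  next
    fix \<Gamma> :: "(real^2) set" assume "hausdorff1_measurable \<Gamma> \<and> hausdorff1 \<Gamma> \<le> 1"
    then have "outer_measure_of ?\<mu> \<Gamma> \<le> ennreal (\<eta> + 4 / (n * l))"
      using l nK sep' by (intro outer_measure_stack_le[of \<delta>]) (auto simp: \<delta>_def)
    also have "\<eta> + 4 / (n * l) \<le> \<epsilon>"
    proof -
      have "\<eta> \<le> e / 2" using P P2 e by (simp add: \<eta> field_simps)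
      moreover have "8 / (l * e) \<le> n" using K nK by linarith
      then have "4 / (n * l) \<le> e / 2" using l e nK by (simp add: field_simps)
      ultimately show ?thesis using e by linarith
    qed
    finally show "outer_measure_of ?\<mu> \<Gamma> \<le> ennreal \<epsilon>" by (simp add: ennreal_leI)
  qed
qed

end
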